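(* Let $L$ be a finite ranked lattice with top element $1$, listed in some fixed order as $L=(x_1,x_2,\ldots,x_n)$, and let $G=\big(q^{\mathrm{rank}(L)-\mathrm{rank}(x_i\vee x_j)}\big)_{1\leq i,j\leq n}$ over $\mathbb{Z}[q]$. Let $Z=(\zeta(x_i,x_j))_{1\leq i,j\leq n}$ where $\zeta(x,y)=1$ if $x\leq y$ and $0$ otherwise. Then: (a) $G=Z\,\mathrm{diag}\big(\chi([x_1,1],q),\chi([x_2,1],q),\ldots,\chi([x_n,1],q)\big)\,Z^t$. (b) Suppose $\chi([x,1],q)$ depends only on the rank of $x$. Let $l=\mathrm{rank}(L)$, $L_k=\{x\in L:\mathrm{rank}(x)=l-k\}$ and $\chi_k(q)=\chi([x,1],q)$ for $x\in L_k$ ($0\leq k\leq l$). If $\chi_i(q)$ is a multiple of $\chi_j(q)$ in $\mathbb{Z}[q]$ whenever $i>j$, then $G$ has special Smith normal form $\mathrm{diag}\big(\chi_0(q)I_{|L_0|},\chi_1(q)I_{|L_1|},\ldots,\chi_l(q)I_{|L_l|}\big)$ over $\mathbb{Z}[q]$.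
   Context: A ranked lattice has a rank function with $\mathrm{rank}(y)=\mathrm{rank}(x)+1$ whenever $y$ covers $x$ and the bottom element of rank $0$; $\mathrm{rank}(L)$ is the rank of the top element $1$. $[x,1]=\{y\in L: x\leq y\}$. The Möbius function $\mu$ of $L$ is given by $(\mu(x_i,x_j))_{i,j}=Z^{-1}$, and the characteristic polynomial of $[x,1]$ is $\chi([x,1],q)=\sum_{y\geq x}\mu(x,y)q^{\mathrm{rank}(L)-\mathrm{rank}(y)}$. $I_m$ is the $m\times m$ identity matrix. For an $m\times n$ matrix $A$ over a commutative ring $R$, a matrix $D$ is a special Smith normal form (SSNF) of $A$ over $R$ if there exist $P\in \mathrm{SL}(m,R)$, $Q\in\mathrm{SL}(n,R)$ with $PAQ=D$, $D$ is diagonal, and $d_{ii}$ is a multiple in $R$ of $d_{jj}$ whenever $i\geq j$. *)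

theory Defs
  imports "Jordan_Normal_Form.Determinant"
begin

text \<open>
  Finite lattices are types of sort \<open>{finite, bounded_lattice}\<close> (a finite nonempty lattice is
  always bounded); \<open>Orderings.bot\<close> and \<open>Orderings.top\<close> are the elements written 0 and 1
  on paper, and the join is \<open>sup\<close>. The polynomial variable $q$ of $\mathbb{Z}[q]$ is the indeterminate of \<open>int poly\<close>.
\<close>

definition covers :: "'a::order \<Rightarrow> 'a \<Rightarrow> bool" where
  "covers y x \<longleftrightarrow> x < y \<and> \<not> (\<exists>z. x < z \<and> z < y)"

definition rank_function :: "('a::bounded_lattice \<Rightarrow> nat) \<Rightarrow> bool" where
  "rank_function rank \<longleftrightarrow> rank Orderings.bot = 0 \<and> (\<forall>x y. covers y x \<longrightarrow> rank y = rank x + 1)"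

definition listing :: "'a list \<Rightarrow> bool" where
  "listing xs \<longleftrightarrow> distinct xs \<and> set xs = UNIV"

definition mat_of_fun :: "'a list \<Rightarrow> ('a \<Rightarrow> 'a \<Rightarrow> 'b) \<Rightarrow> 'b mat" where
  "mat_of_fun xs f = mat (length xs) (length xs) (\<lambda>(i, j). f (xs ! i) (xs ! j))"

definition zeta :: "'a::order \<Rightarrow> 'a \<Rightarrow> 'b::zero_neq_one" where
  "zeta x y = (if x \<le> y then 1 else 0)"

definition is_mobius :: "('a::order \<Rightarrow> 'a \<Rightarrow> int) \<Rightarrow> bool" where
  "is_mobius \<mu> \<longleftrightarrow> (\<forall>xs. listing xs \<longrightarrow>
     inverts_mat (mat_of_fun xs zeta) (mat_of_fun xs \<mu>) \<and>
     inverts_mat (mat_of_fun xs \<mu>) (mat_of_fun xs zeta))"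

text \<open>
  On a finite order there is exactly one \<open>\<mu>\<close> with \<open>is_mobius \<mu>\<close>, whichever listing is used to
  form the matrices: see \<open>is_mobius_mobius\<close> and \<open>is_mobius_unique\<close> below.
\<close>
definition mobius :: "'a::order \<Rightarrow> 'a \<Rightarrow> int" where
  "mobius = (THE \<mu>. is_mobius \<mu>)"

text \<open>
  The characteristic polynomial of the interval $[x,1]$. The subtraction on \<open>nat\<close> does not
  truncate when \<open>rank\<close> is a rank function on a finite lattice.
\<close>
definition interval_char_poly ::
    "('a::{finite, bounded_lattice} \<Rightarrow> nat) \<Rightarrow> 'a \<Rightarrow> int poly" where
  "interval_char_poly rank x =
     (\<Sum>y\<in>{x..Orderings.top}. monom (mobius x y) (rank Orderings.top - rank y))"

text \<open>Used only for \<open>k \<le> rank top\<close>, where the subtraction does not truncate.\<close>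
definition corank_level :: "('a::bounded_lattice \<Rightarrow> nat) \<Rightarrow> nat \<Rightarrow> 'a set" where
  "corank_level rank k = {x. rank x = rank Orderings.top - k}"

definition join_mat ::
    "('a::bounded_lattice \<Rightarrow> nat) \<Rightarrow> 'a list \<Rightarrow> int poly mat" where
  "join_mat rank xs = mat_of_fun xs (\<lambda>x y. monom 1 (rank Orderings.top - rank (sup x y)))"

definition special_linear :: "nat \<Rightarrow> 'r::comm_ring_1 mat set" where
  "special_linear n = {P \<in> carrier_mat n n. det P = 1}"

definition is_SSNF :: "'r::comm_ring_1 mat \<Rightarrow> 'r mat \<Rightarrow> bool" where
  "is_SSNF A D \<longleftrightarrow>
     (\<exists>P \<in> special_linear (dim_row A). \<exists>Q \<in> special_linear (dim_col A). P * A * Q = D) \<and>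
     diagonal_mat D \<and>
     (\<forall>i < min (dim_row D) (dim_col D). \<forall>j \<le> i. D $$ (j, j) dvd D $$ (i, i))"

lemma sum_listing:
  assumes "listing xs"
  shows "(\<Sum>k = 0..<length xs. f (xs ! k)) = (\<Sum>z\<in>UNIV. f z)"
proof -
  have "bij_betw ((!) xs) {0..<length xs} UNIV"
    using assms bij_betw_nth[of xs "{0..<length xs}" UNIV]
    by (auto simp: listing_def atLeast0LessThan)
  then show ?thesis by (rule sum.reindex_bij_betw)
qed

lemma inverts_mat_of_fun:
  fixes f g :: "'a \<Rightarrow> 'a \<Rightarrow> 'b::comm_ring_1"
  assumes "listing xs"
  shows "inverts_mat (mat_of_fun xs f) (mat_of_fun xs g) \<longleftrightarrow>
    (\<forall>x y. (\<Sum>z\<in>UNIV. f x z * g z y) = (if x = y then 1 else 0))" (is "_ \<longleftrightarrow> ?R")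
proof -
  have D: "distinct xs" and S: "set xs = UNIV" using assms by (auto simp: listing_def)
  define P where "P x y \<longleftrightarrow> (\<Sum>z\<in>UNIV. f x z * g z y) = (if x = y then 1 else 0)" for x y
  have "inverts_mat (mat_of_fun xs f) (mat_of_fun xs g) \<longleftrightarrow>
     (\<forall>i<length xs. \<forall>j<length xs. (\<Sum>k = 0..<length xs. f (xs ! i) (xs ! k) * g (xs ! k) (xs ! j))
       = (if i = j then 1 else 0))"
    by (auto simp: inverts_mat_def mat_of_fun_def mat_eq_iff scalar_prod_def)
  also have "\<dots> \<longleftrightarrow> (\<forall>i<length xs. \<forall>j<length xs. P (xs ! i) (xs ! j))"
  proof -
    have "(\<Sum>k = 0..<length xs. f (xs ! i) (xs ! k) * g (xs ! k) (xs ! j))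
            = (if i = j then 1 else 0) \<longleftrightarrow> P (xs ! i) (xs ! j)"
      if "i < length xs" "j < length xs" for i j
      unfolding P_def sum_listing[OF assms, of "\<lambda>z. f (xs ! i) z * g z (xs ! j)"]
      by (simp only: nth_eq_iff_index_eq[OF D that])
    then show ?thesis by blast
  qed
  also have "\<dots> \<longleftrightarrow> (\<forall>x\<in>set xs. \<forall>y\<in>set xs. P x y)"
    by (simp only: all_set_conv_all_nth)
  also have "\<dots> \<longleftrightarrow> ?R"
    by (simp only: S P_def ball_UNIV)
  finally show ?thesis .
qed

lemma ex_listing: "\<exists>xs :: 'a::finite list. listing xs"
  using finite_distinct_list[of "UNIV :: 'a set"] by (auto simp: listing_def)

lemma fun_inverse_unique:
  fixes f g h :: "'a::finite \<Rightarrow> 'a \<Rightarrow> 'b::comm_ring_1"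
  assumes l: "\<And>x y. (\<Sum>z\<in>UNIV. g x z * f z y) = (if x = y then 1 else 0)"
    and r: "\<And>x y. (\<Sum>z\<in>UNIV. f x z * h z y) = (if x = y then 1 else 0)"
  shows "g = h"
proof (intro ext)
  fix x y
  have "g x y = (\<Sum>z\<in>UNIV. g x z * (\<Sum>w\<in>UNIV. f z w * h w y))"
    by (simp add: r if_distrib[where f = "\<lambda>t. _ * t"] cong: if_cong)
  also have "\<dots> = (\<Sum>w\<in>UNIV. (\<Sum>z\<in>UNIV. g x z * f z w) * h w y)"
    unfolding sum_distrib_left sum_distrib_right
    by (subst sum.swap) (simp add: mult.assoc)
  also have "\<dots> = h x y" by (simp add: l if_distrib[where f = "\<lambda>t. t * _"] cong: if_cong)
  finally show "g x y = h x y" .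
qed

text \<open>
  Recursively defined left and right inverses of \<open>zeta\<close>, used only to show that \<open>mobius\<close> exists.
\<close>
function mob_l :: "'a::{finite, order} \<Rightarrow> 'a \<Rightarrow> int" where
  "mob_l x y = (if x = y then 1 else - (\<Sum>z\<in>{z. z < y}. mob_l x z))"
  by auto
termination
  by (relation "measure (\<lambda>(x, y). card {z. z < y})")
    (auto intro!: psubset_card_mono dest: less_trans)

function mob_r :: "'a::{finite, order} \<Rightarrow> 'a \<Rightarrow> int" where
  "mob_r x y = (if x = y then 1 else - (\<Sum>z\<in>{z. x < z}. mob_r z y))"
  by auto
termination
  by (relation "measure (\<lambda>(x, y). card {z. x < z})")
    (auto intro!: psubset_card_mono dest: less_trans)

declare mob_l.simps [simp del] mob_r.simps [simp del]

lemma mob_l_zero: "\<not> x \<le> y \<Longrightarrow> mob_l x y = 0"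
proof (induction x y rule: mob_l.induct)
  case (1 x y)
  have "mob_l x z = 0" if "z < y" for z
  proof (rule 1(1))
    show "x \<noteq> y" using 1(2) by auto
    show "z \<in> {z. z < y}" using that by simp
    show "\<not> x \<le> z" using that 1(2) by (auto dest: order.trans less_imp_le)
  qed
  then show ?case using 1(2) by (subst mob_l.simps) auto
qed

lemma mob_l_zeta:
  "(\<Sum>z\<in>UNIV. mob_l x z * zeta z y) = (if x = y then 1 else 0)"
proof -
  have "(\<Sum>z\<in>UNIV. mob_l x z * zeta z y) = (\<Sum>z\<in>{z. z \<le> y}. mob_l x z)"
    by (rule sum.mono_neutral_cong_right) (auto simp: zeta_def)
  also have "{z. z \<le> y} = insert y {z. z < y}" by auto
  also have "(\<Sum>z\<in>insert y {z. z < y}. mob_l x z) = mob_l x y + (\<Sum>z\<in>{z. z < y}. mob_l x z)"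
    by simp
  also have "\<dots> = (if x = y then 1 else 0)"
  proof (cases "x = y")
    case True
    have "(\<Sum>z\<in>{z. z < y}. mob_l x z) = 0"
      using True by (intro sum.neutral ballI mob_l_zero) (auto dest: leD)
    then show ?thesis using True by (subst mob_l.simps) simp
  next
    case False
    then show ?thesis by (subst mob_l.simps) simp
  qed
  finally show ?thesis .
qed

lemma mob_r_zero: "\<not> x \<le> y \<Longrightarrow> mob_r x y = 0"
proof (induction x y rule: mob_r.induct)
  case (1 x y)
  have "mob_r z y = 0" if "x < z" for z
  proof (rule 1(1))
    show "x \<noteq> y" using 1(2) by auto
    show "z \<in> {z. x < z}" using that by simp
    show "\<not> z \<le> y" using that 1(2) by (auto dest: order.trans less_imp_le)
  qed
  then show ?case using 1(2) by (subst mob_r.simps) auto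
qed

lemma zeta_mob_r:
  "(\<Sum>z\<in>UNIV. zeta x z * mob_r z y) = (if x = y then 1 else 0)"
proof -
  have "(\<Sum>z\<in>UNIV. zeta x z * mob_r z y) = (\<Sum>z\<in>{z. x \<le> z}. mob_r z y)"
    by (rule sum.mono_neutral_cong_right) (auto simp: zeta_def)
  also have "{z. x \<le> z} = insert x {z. x < z}" by auto
  also have "(\<Sum>z\<in>insert x {z. x < z}. mob_r z y) = mob_r x y + (\<Sum>z\<in>{z. x < z}. mob_r z y)"
    by simp
  also have "\<dots> = (if x = y then 1 else 0)"
  proof (cases "x = y")
    case True
    have "(\<Sum>z\<in>{z. x < z}. mob_r z y) = 0"
      using True by (intro sum.neutral ballI mob_r_zero) (auto dest: leD)
    then show ?thesis using True by (subst mob_r.simps) simp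
  next
    case False
    then show ?thesis by (subst mob_r.simps) simp
  qed
  finally show ?thesis .
qed

lemma is_mobius_iff:
  fixes \<mu> :: "'a::{finite, order} \<Rightarrow> 'a \<Rightarrow> int"
  shows "is_mobius \<mu> \<longleftrightarrow>
    (\<forall>x y. (\<Sum>z\<in>UNIV. zeta x z * \<mu> z y) = (if x = y then 1 else 0)) \<and>
    (\<forall>x y. (\<Sum>z\<in>UNIV. \<mu> x z * zeta z y) = (if x = y then 1 else 0))"
  unfolding is_mobius_def using ex_listing[where 'a = 'a]
  by (auto simp: inverts_mat_of_fun)

lemma is_mobius_unique:
  fixes \<mu> \<nu> :: "'a::{finite, order} \<Rightarrow> 'a \<Rightarrow> int"
  assumes "is_mobius \<mu>" "is_mobius \<nu>"
  shows "\<mu> = \<nu>"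
  using assms fun_inverse_unique[of \<mu> zeta \<nu>] unfolding is_mobius_iff by blast

lemma is_mobius_mobius:
  "is_mobius (mobius :: 'a::{finite, order} \<Rightarrow> 'a \<Rightarrow> int)"
proof -
  have eq: "mob_l = (mob_r :: 'a \<Rightarrow> 'a \<Rightarrow> int)"
    by (rule fun_inverse_unique[where f = zeta]) (rule mob_l_zeta zeta_mob_r)+
  have l: "is_mobius (mob_l :: 'a \<Rightarrow> 'a \<Rightarrow> int)"
    unfolding is_mobius_iff
  proof (intro conjI allI)
    fix x y :: 'a
    show "(\<Sum>z\<in>UNIV. zeta x z * mob_l z y) = (if x = y then 1 else 0)"
      unfolding eq by (rule zeta_mob_r)
    show "(\<Sum>z\<in>UNIV. mob_l x z * zeta z y) = (if x = y then 1 else 0)"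
      by (rule mob_l_zeta)
  qed
  show ?thesis
    unfolding mobius_def
    by (rule theI[where P = is_mobius, OF l]) (erule is_mobius_unique[OF _ l])
qed

end

theory Submission imports Defs begin

text \<open>
  Part (a) is Moebius inversion: the sum of the characteristic polynomials of $[z,1]$ over all
  $z \geq x \vee y$ collapses to $q^{\mathrm{rank}(L)-\mathrm{rank}(x\vee y)}$. The factorisation
  holds as well when the middle factor is indexed by a different listing of the lattice, and a
  listing by increasing corank turns the diagonal factor into the required block matrix. The outer
  factors then have determinant $\pm 1$; a sign $-1$ is absorbed by scaling one row and the
  corresponding column by $-1$, which leaves a diagonal matrix unchanged.
\<close>

section \<open>Moebius inversion for characteristic polynomials\<close>

text \<open>Inverses of \<open>zeta\<close> are unique, so \<open>mobius\<close> coincides with the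
  recursively defined \<open>mob_r\<close>, whose support is known. This lets sums over an interval
  run over the whole lattice.\<close>

lemma mobius_zero:
  fixes x y :: "'a::{finite, order}"
  assumes "\<not> x \<le> y"
  shows "mobius x y = 0"
proof -
  have "mobius = (mob_r :: 'a \<Rightarrow> 'a \<Rightarrow> int)"
  proof (rule fun_inverse_unique[where f = zeta])
    show "(\<Sum>z\<in>UNIV. mobius x z * zeta z y) = (if x = y then 1 else 0)" for x y :: 'a
      using is_mobius_mobius[where 'a = 'a] unfolding is_mobius_iff by blast
  qed (rule zeta_mob_r)
  then show ?thesis using assms by (simp add: mob_r_zero)
qed

text \<open>After the two sums are exchanged, the coefficient attached to \<open>w\<close> is the
  \<open>(u, w)\<close> entry of \<open>zeta\<close> times \<open>mobius\<close>, the identity, so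
  only \<open>w = u\<close> survives.\<close>

lemma sum_zeta_interval_char_poly:
  "(\<Sum>z\<in>UNIV. zeta u z * interval_char_poly rank z) = monom 1 (rank Orderings.top - rank u)"
proof -
  define c where "c w = rank Orderings.top - rank w" for w
  have "(\<Sum>z\<in>UNIV. zeta u z * interval_char_poly rank z)
      = (\<Sum>z\<in>UNIV. \<Sum>w\<in>UNIV. monom (zeta u z * mobius z w) (c w))"
  proof (rule sum.cong[OF refl])
    fix z
    have "interval_char_poly rank z = (\<Sum>w\<in>UNIV. monom (mobius z w) (c w))"
      unfolding interval_char_poly_def c_def
      by (rule sum.mono_neutral_left) (auto simp: mobius_zero)
    then show "zeta u z * interval_char_poly rank z
        = (\<Sum>w\<in>UNIV. monom (zeta u z * mobius z w) (c w))"
      by (simp add: zeta_def)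
  qed
  also have "\<dots> = (\<Sum>w\<in>UNIV. monom (\<Sum>z\<in>UNIV. zeta u z * mobius z w) (c w))"
    by (subst sum.swap) (simp add: monom_sum)
  also have "\<dots> = (\<Sum>w\<in>UNIV. if u = w then monom 1 (c w) else 0)"
    using is_mobius_mobius[where 'a = 'a]
    by (intro sum.cong) (auto simp: is_mobius_iff)
  also have "\<dots> = monom 1 (c u)" by simp
  finally show ?thesis by (simp add: c_def)
qed

section \<open>Factorisation of the join matrix\<close>

lemma length_listing:
  fixes xs :: "'a::finite list"
  assumes "listing xs"
  shows "length xs = card (UNIV :: 'a set)"
  using assms distinct_card[of xs] by (simp add: listing_def)

text \<open>Separate row and column listings let the zeta matrix reorder the lattice by itself,
  without permutation matrices.\<close>

definition mat_of_fun2 :: "'a list \<Rightarrow> 'b list \<Rightarrow> ('a \<Rightarrow> 'b \<Rightarrow> 'c) \<Rightarrow> 'c mat" where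
  "mat_of_fun2 xs ys f = mat (length xs) (length ys) (\<lambda>(i, j). f (xs ! i) (ys ! j))"

lemma mat_of_fun2_carrier [simp]:
  "mat_of_fun2 xs ys f \<in> carrier_mat (length xs) (length ys)"
  by (simp add: mat_of_fun2_def)

lemma mat_of_fun2_same: "mat_of_fun2 xs xs f = mat_of_fun xs f"
  by (simp add: mat_of_fun2_def mat_of_fun_def)

text \<open>An element lies above \<open>sup x y\<close> iff it lies above both \<open>x\<close> and
  \<open>y\<close>, so the two outer zeta factors of an entry merge into one and Moebius inversion
  applies. Taking \<open>ys = xs\<close> gives part (a); part (b) takes \<open>ys\<close> ordered by
  corank.\<close>

lemma join_mat_factorization:
  fixes rank :: "'a::{finite, bounded_lattice} \<Rightarrow> nat"
  assumes "listing ys"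
  shows "join_mat rank xs =
    mat_of_fun2 xs ys zeta
    * mat_diag (length ys) (\<lambda>i. interval_char_poly rank (ys ! i))
    * transpose_mat (mat_of_fun2 xs ys zeta)" (is "?G = ?W * ?D * ?Wt")
proof (rule eq_matI)
  have WD: "?W * ?D = mat_of_fun2 xs ys (\<lambda>x y. zeta x y * interval_char_poly rank y)"
    by (subst mat_diag_mult_right[OF mat_of_fun2_carrier])
      (auto simp: mat_of_fun2_def intro!: eq_matI)
  fix i j assume "i < dim_row (?W * ?D * ?Wt)" "j < dim_col (?W * ?D * ?Wt)"
  then have ij: "i < length xs" "j < length xs" by (simp_all add: mat_of_fun2_def)
  have "(?W * ?D * ?Wt) $$ (i, j) = (\<Sum>k = 0..<length ys.
      zeta (xs ! i) (ys ! k) * interval_char_poly rank (ys ! k) * zeta (xs ! j) (ys ! k))"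
    unfolding WD using ij by (simp add: mat_of_fun2_def scalar_prod_def)
  also have "\<dots> = (\<Sum>z\<in>UNIV. zeta (xs ! i) z * interval_char_poly rank z * zeta (xs ! j) z)"
    by (rule sum_listing[OF assms])
  also have "\<dots> = (\<Sum>z\<in>UNIV. zeta (sup (xs ! i) (xs ! j)) z * interval_char_poly rank z)"
    by (intro sum.cong) (auto simp: zeta_def)
  also have "\<dots> = ?G $$ (i, j)"
    using ij by (simp add: sum_zeta_interval_char_poly join_mat_def mat_of_fun_def)
  finally show "?G $$ (i, j) = (?W * ?D * ?Wt) $$ (i, j)" ..
qed (simp_all add: join_mat_def mat_of_fun_def mat_of_fun2_def)

text \<open>Gives the outer factor an inverse with integer entries, hence a unit determinant over
  the polynomial ring.\<close>

lemma mobius_mat_times_zeta_mat: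
  fixes xs ys :: "'a::{finite, order} list"
  assumes "listing xs" "listing ys"
  shows "mat_of_fun2 ys xs (\<lambda>x y. of_int (mobius x y)) * mat_of_fun2 xs ys zeta
    = (1\<^sub>m (length ys) :: 'r::comm_ring_1 mat)" (is "?V * ?W = _")
proof (rule eq_matI)
  fix i j assume "i < dim_row (1\<^sub>m (length ys) :: 'r mat)" "j < dim_col (1\<^sub>m (length ys) :: 'r mat)"
  then have ij: "i < length ys" "j < length ys" by simp_all
  have "(?V * ?W) $$ (i, j)
      = (\<Sum>k = 0..<length xs. of_int (mobius (ys ! i) (xs ! k)) * zeta (xs ! k) (ys ! j))"
    using ij by (simp add: mat_of_fun2_def scalar_prod_def)
  also have "\<dots> = (\<Sum>z\<in>UNIV. of_int (mobius (ys ! i) z) * zeta z (ys ! j))"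
    by (rule sum_listing[OF assms(1)])
  also have "\<dots> = of_int (\<Sum>z\<in>UNIV. mobius (ys ! i) z * zeta z (ys ! j))"
    unfolding of_int_sum by (intro sum.cong) (auto simp: zeta_def)
  also have "\<dots> = of_int (if ys ! i = ys ! j then 1 else 0)"
    using is_mobius_mobius[where 'a = 'a] by (simp add: is_mobius_iff)
  also have "\<dots> = 1\<^sub>m (length ys) $$ (i, j)"
    using ij assms(2) by (simp add: listing_def nth_eq_iff_index_eq)
  finally show "(?V * ?W) $$ (i, j) = 1\<^sub>m (length ys) $$ (i, j)" .
qed (simp_all add: mat_of_fun2_def)

section \<open>Adjusting determinants to 1\<close>

lemma det_mat_diag:
  "det (mat_diag n d) = (\<Prod>i<n. d i)" for d :: "nat \<Rightarrow> 'r::comm_ring_1"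
  by (subst det_upper_triangular[of _ n])
    (auto simp: upper_triangular_def mat_diag_def prod_list_diag_prod lessThan_atLeast0)

text \<open>The units of the ring are the constants 1 and -1.\<close>

lemma int_poly_unit_square:
  fixes p :: "int poly"
  assumes "p dvd 1"
  shows "p * p = 1"
proof -
  obtain c where "p = [:c:]" "c dvd 1" using assms unfolding is_unit_poly_iff by blast
  then show ?thesis by (auto simp: one_pCons zdvd1_eq abs_if split: if_splits)
qed

text \<open>Multiplying by \<open>V\<close> on the left and its transpose on the right strips off
  \<open>W\<close>, but both multipliers have determinant \<open>e = det V\<close>, possibly -1. An
  extra diagonal factor \<open>S\<close> of determinant \<open>e\<close> on each side makes both
  determinants \<open>e * e = 1\<close>.\<close>

lemma congruence_diag_special_linear:
  fixes W V :: "int poly mat"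
  assumes n: "n > 0"
    and W: "W \<in> carrier_mat n n" and V: "V \<in> carrier_mat n n" and VW: "V * W = 1\<^sub>m n"
  shows "\<exists>P\<in>special_linear n. \<exists>Q\<in>special_linear n.
    P * (W * mat_diag n d * transpose_mat W) * Q = mat_diag n d"
proof -
  define e where "e = det V"
  \<comment> \<open>Conjugation by \<open>S\<close> multiplies only the entry \<open>d 0\<close>, by
    \<open>e * e = 1\<close>. Since \<open>n > 0\<close>, position 0 exists and
    \<open>det S = e\<close>.\<close>
  define S where "S = mat_diag n (\<lambda>i. if i = 0 then e else 1)"
  let ?D = "mat_diag n d"
  have "e * det W = 1" using det_mult[OF V W] VW by (simp add: e_def)
  then have ee: "e * e = 1" by (intro int_poly_unit_square) (metis dvd_triv_left)
  have S: "S \<in> carrier_mat n n" by (simp add: S_def)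
  have D: "?D \<in> carrier_mat n n" by simp
  have detS: "det S = e" using n by (simp add: S_def det_mat_diag)
  have WtVt: "transpose_mat W * transpose_mat V = 1\<^sub>m n"
    using transpose_mult[OF V W] VW by simp
  have "S * V * (W * ?D * transpose_mat W) * (transpose_mat V * S)
      = S * (V * W) * ?D * (transpose_mat W * transpose_mat V) * S"
    using S V W D by (simp add: assoc_mult_mat[of _ n n _ n _ n] mult_carrier_mat[of _ n n _ n])
  also have "\<dots> = S * ?D * S"
    using S D by (simp add: VW WtVt mult_carrier_mat[of _ n n _ n] right_mult_one_mat[of _ n])
  also have "\<dots> = ?D"
  proof -
    have "e * d 0 * e = d 0" using ee by (metis mult.assoc mult.commute mult_1)
    then show ?thesis unfolding S_def mat_diag_diag
      by (intro arg_cong[where f = "mat_diag n"] ext) simp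
  qed
  finally have "S * V * (W * ?D * transpose_mat W) * (transpose_mat V * S) = ?D" .
  moreover have "S * V \<in> special_linear n" "transpose_mat V * S \<in> special_linear n"
    using S V ee by (auto simp: special_linear_def det_mult[of _ n] det_transpose detS e_def)
  ultimately show ?thesis by blast
qed

section \<open>Listing the lattice by corank\<close>

text \<open>A minimal element strictly above \<open>x\<close> covers it and has rank one higher;
  climb by induction on the number of elements above. Hence the corank does not truncate and every
  element lies in some level.\<close>

lemma rank_le_rank_top:
  fixes rank :: "'a::{finite, bounded_lattice} \<Rightarrow> nat"
  assumes "rank_function rank"
  shows "rank x \<le> rank Orderings.top"
proof (induction "card {z. x < z}" arbitrary: x rule: less_induct)
  case less
  show ?case
  proof (cases "x = Orderings.top")
    case False
    then have "{z. x < z} \<noteq> {}" by (auto simp: top.not_eq_extremum)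
    then obtain y where y: "x < y" and min: "\<And>z. x < z \<Longrightarrow> z \<le> y \<Longrightarrow> y = z"
      using finite_has_minimal[of "{z. x < z}"] by auto
    have "covers y x" using y min unfolding covers_def by (metis order.strict_iff_order)
    then have "rank y = rank x + 1" using assms by (auto simp: rank_function_def)
    moreover have "card {z. y < z} < card {z. x < z}"
      using y by (intro psubset_card_mono) (auto dest: less_trans)
    ultimately show ?thesis using less[of y] by simp
  qed simp
qed

text \<open>Listing level after level turns a function constant on each level into a list of
  constant blocks.\<close>

lemma ex_listing_by_corank:
  fixes rank :: "'a::{finite, bounded_lattice} \<Rightarrow> nat"
  assumes "rank_function rank"
  obtains ys where "listing ys"
    and "\<And>f c. (\<And>k x. k \<le> rank Orderings.top \<Longrightarrow> x \<in> corank_level rank k \<Longrightarrow> c k = f x) \<Longrightarrow>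
      map f ys = concat (map (\<lambda>k. replicate (card (corank_level rank k)) (c k))
        [0..<rank Orderings.top + 1])"
proof -
  let ?l = "rank Orderings.top"
  have "\<exists>zs. distinct zs \<and> set zs = corank_level rank k" for k
    using finite_distinct_list[of "corank_level rank k"] by auto
  then obtain level where
    level: "\<And>k. distinct (level k)" "\<And>k. set (level k) = corank_level rank k" by metis
  define ys where "ys = concat (map level [0..<?l + 1])"
  have "x \<in> set ys" for x
  proof -
    have "x \<in> corank_level rank (?l - rank x)"
      using rank_le_rank_top[OF assms, of x] by (simp add: corank_level_def)
    then show ?thesis
      by (auto simp: ys_def level less_Suc_eq_le simp del: upt_Suc intro!: bexI[of _ "?l - rank x"])
  qed
  \<comment> \<open>The bound on \<open>m\<close> keeps \<open>?l - k\<close> from truncating, so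
    distinct indices give disjoint levels.\<close>
  moreover have "distinct (concat (map level [0..<m]))" if "m \<le> ?l + 1" for m
    using that
  proof (induction m)
    case (Suc m)
    have "set (concat (map level [0..<m])) \<inter> set (level m) = {}"
      using Suc.prems by (auto simp: level corank_level_def)
    then show ?case using Suc by (simp add: level(1))
  qed simp
  then have "distinct ys" unfolding ys_def by blast
  ultimately have "listing ys" by (auto simp: listing_def)
  moreover have "map f ys =
      concat (map (\<lambda>k. replicate (card (corank_level rank k)) (c k)) [0..<?l + 1])"
    if c: "\<And>k x. k \<le> ?l \<Longrightarrow> x \<in> corank_level rank k \<Longrightarrow> c k = f x" for f :: "'a \<Rightarrow> 'b" and c
  proof -
    have "map f (level k) = replicate (card (corank_level rank k)) (c k)" if "k \<le> ?l" for k
    proof (rule replicate_eqI)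
      show "length (map f (level k)) = card (corank_level rank k)"
        using distinct_card[OF level(1), of k] by (simp add: level(2))
      show "y = c k" if "y \<in> set (map f (level k))" for y
        using that c[OF \<open>k \<le> ?l\<close>] by (auto simp: level(2))
    qed
    then show ?thesis
      unfolding ys_def map_concat map_map
      by (intro arg_cong[where f = concat] map_cong) auto
  qed
  ultimately show thesis by (rule that)
qed

section \<open>The block diagonal form\<close>

text \<open>Reduces the block matrix to a list of diagonal entries, on which divisibility can be
  checked by position.\<close>

lemma diag_block_mat_scalar_blocks:
  fixes c :: "nat \<Rightarrow> 'r::comm_ring_1" and m :: "nat \<Rightarrow> nat"
  defines "cs \<equiv> \<lambda>ks. concat (map (\<lambda>k. replicate (m k) (c k)) ks)"
  shows "diag_block_mat (map (\<lambda>k. c k \<cdot>\<^sub>m 1\<^sub>m (m k)) ks)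
    = mat_diag (length (cs ks)) (\<lambda>i. cs ks ! i)"
proof (induction ks)
  case Nil
  show ?case by (auto simp: cs_def mat_diag_def intro!: eq_matI)
next
  case (Cons k ks)
  have "cs (k # ks) = replicate (m k) (c k) @ cs ks" by (simp add: cs_def)
  then show ?case
    by (auto simp: Cons.IH Let_def mat_diag_def nth_append intro!: eq_matI)
qed

text \<open>Reflexivity covers two positions in the same block; positions in different blocks
  inherit the relation from \<open>c\<close>.\<close>

lemma sorted_wrt_concat_replicate:
  assumes "reflp R" and "sorted_wrt R (map c ks)"
  shows "sorted_wrt R (concat (map (\<lambda>k. replicate (m k) (c k)) ks))"
proof -
  have "sorted_wrt R (replicate n x)" for n x
    using assms(1) by (induction n) (auto simp: reflp_def)
  then show ?thesis
    using assms(2) by (induction ks) (auto simp: sorted_wrt_append)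
qed

theorem theorem6p6:
  fixes rank :: "'a::{finite, bounded_lattice} \<Rightarrow> nat"
    and xs :: "'a list"
  assumes "rank_function rank"
    and "listing xs"
  shows "(join_mat rank xs =
           mat_of_fun xs zeta
           * mat_diag (length xs) (\<lambda>i. interval_char_poly rank (xs ! i))
           * transpose_mat (mat_of_fun xs zeta))
    \<and> (\<forall>\<chi> :: nat \<Rightarrow> int poly.
           (\<forall>x y. rank x = rank y \<longrightarrow> interval_char_poly rank x = interval_char_poly rank y) \<longrightarrow>
           (\<forall>k \<le> rank Orderings.top. \<forall>x \<in> corank_level rank k. \<chi> k = interval_char_poly rank x) \<longrightarrow>
           (\<forall>i \<le> rank Orderings.top. \<forall>j < i. \<chi> j dvd \<chi> i) \<longrightarrow>
           is_SSNF (join_mat rank xs)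
             (diag_block_mat
               (map (\<lambda>k. \<chi> k \<cdot>\<^sub>m 1\<^sub>m (card (corank_level rank k))) [0..<rank Orderings.top + 1])))"
proof (intro conjI allI impI)
  show "join_mat rank xs =
      mat_of_fun xs zeta
      * mat_diag (length xs) (\<lambda>i. interval_char_poly rank (xs ! i))
      * transpose_mat (mat_of_fun xs zeta)"
    using join_mat_factorization[OF assms(2), of rank xs] by (simp add: mat_of_fun2_same)
next
  fix \<chi> :: "nat \<Rightarrow> int poly"
  let ?l = "rank Orderings.top"
  let ?D = "diag_block_mat (map (\<lambda>k. \<chi> k \<cdot>\<^sub>m 1\<^sub>m (card (corank_level rank k))) [0..<?l + 1])"
  assume \<chi>: "\<forall>k \<le> ?l. \<forall>x \<in> corank_level rank k. \<chi> k = interval_char_poly rank x"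
    and dvd: "\<forall>i \<le> ?l. \<forall>j < i. \<chi> j dvd \<chi> i"
  obtain ys where ys: "listing ys" and map_ys:
    "map (interval_char_poly rank) ys
      = concat (map (\<lambda>k. replicate (card (corank_level rank k)) (\<chi> k)) [0..<?l + 1])"
      (is "_ = ?cs")
    using ex_listing_by_corank[OF assms(1)] \<chi> by metis
  define n where "n = card (UNIV :: 'a set)"
  have n: "n > 0" by (simp add: n_def card_gt_0_iff)
  have len: "length xs = n" "length ys = n"
    using assms(2) ys by (simp_all add: length_listing n_def)
  have lcs: "length ?cs = n" using len(2) by (metis length_map map_ys)
  \<comment> \<open>Two readings of the same diagonal: \<open>D\<close> shows the block values and
    yields divisibility, \<open>D'\<close> matches the middle factor of the factorisation along
    \<open>ys\<close>.\<close>
  have D: "?D = mat_diag n (\<lambda>i. ?cs ! i)"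
    unfolding diag_block_mat_scalar_blocks lcs ..
  have D': "?D = mat_diag n (\<lambda>i. interval_char_poly rank (ys ! i))"
    unfolding D map_ys[symmetric] using len(2) by (auto simp: mat_diag_def intro!: eq_matI)
  have "sorted_wrt (dvd) (map \<chi> [0..<?l + 1])"
    using dvd by (auto simp: sorted_wrt_iff_nth_less simp del: upt_Suc)
  then have sorted: "sorted_wrt (dvd) ?cs"
    by (intro sorted_wrt_concat_replicate) (simp_all add: reflp_def)
  have "?cs ! j dvd ?cs ! i" if "i < n" "j \<le> i" for i j
    using that sorted lcs by (cases "j = i") (auto simp: sorted_wrt_iff_nth_less simp del: upt_Suc)
  then have "\<forall>i < min (dim_row ?D) (dim_col ?D). \<forall>j \<le> i. ?D $$ (j, j) dvd ?D $$ (i, i)"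
    unfolding D by (auto simp: mat_diag_def)
  moreover have "diagonal_mat ?D"
    unfolding D by (auto simp: mat_diag_def diagonal_mat_def)
  \<comment> \<open>Here \<open>W\<close> is the zeta matrix with rows listed by \<open>xs\<close>
    and columns by \<open>ys\<close>; \<open>V\<close> is the Moebius matrix with the listings
    swapped.\<close>
  moreover have "\<exists>P\<in>special_linear n. \<exists>Q\<in>special_linear n.
      P * join_mat rank xs * Q = ?D"
    unfolding join_mat_factorization[OF ys] len(2) D'
    by (rule congruence_diag_special_linear[OF _ _ _
          mobius_mat_times_zeta_mat[OF assms(2) ys, unfolded len(2)]])
      (simp_all add: mat_of_fun2_def len n)
  ultimately show "is_SSNF (join_mat rank xs) ?D"
    by (simp add: is_SSNF_def join_mat_def mat_of_fun_def len)
qed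

end
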